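(* Let $n\ge 2$, $1\le d\le n-1$, $q=n-d$, $A\in\mathbf{Gr}(d,n)$ and $k\in\mathbb{Z}^n$. Suppose that $f\in\mathcal{T}'$ and $R_{d,A}f\in L^1(\mathbb{T}^n)$. If $k\perp A$, then $$\hat f(k)=\int_{[0,1]^q}R_{d,A}f(\phi_A(T,0))\,\exp\bigl(-2\pi i(k_{1_A}t_{1_A}+\cdots+k_{q_A}t_{q_A})\bigr)\,dT.$$
   Context: Let $\mathbb{T}^n=\mathbb{R}^n/\mathbb{Z}^n$, $\mathcal{T}=C^\infty(\mathbb{T}^n)$, and let $\mathcal{T}'$ be its dual, the space of periodic distributions, with duality pairing $(\cdot,\cdot)$ (so $(f,g)=\int_{\mathbb{T}^n}fg$ for functions). Fourier coefficients are $\hat f(k)=(f,e^{-2\pi i k\cdot x})$, $k\in\mathbb{Z}^n$. $\mathbf{Gr}(d,n)$ is the set of all $d$-dimensional linear subspaces of $\mathbb{Q}^n$; $k\perp A$ means $k\cdot v=0$ for all $v\in A$. Radon transform: for $f\in\mathcal{T}$ and linearly independent $v_1,\dots,v_d\in\mathbb{Z}^n$, with $A=\{v_1,\dots,v_d\}$, $R_df(x,A)=\int_{[0,1]^d}f(x+t_1v_1+\cdots+t_dv_d)\,dt_1\cdots dt_d$. For $f\in\mathcal{T}'$, $R_df(\cdot,A)\in\mathcal{T}'$ is defined by $(R_df(\cdot,A),g)=(f,R_dg(\cdot,A))$ for all $g\in\mathcal{T}$. This depends only on the subspace of $\mathbb{Q}^n$ spanned by $A$, so $R_df(\cdot,A)$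 is regarded as defined for $A\in\mathbf{Gr}(d,n)$; write $R_{d,A}f=R_df(\cdot,A)$. Coordinates $\phi_A$: represent $A\in\mathbf{Gr}(d,n)$ by linearly independent integer vectors $v_1,\dots,v_d\in\mathbb{Z}^n$ spanning it, and let $V\subset\mathbb{R}^n$ be their real span. Fix distinct standard unit vectors $e_{1_A},\dots,e_{q_A}\in\{e_1,\dots,e_n\}$ with $e_{i_A}\notin V$ such that $\{v_1,\dots,v_d,e_{1_A},\dots,e_{q_A}\}$ spans $\mathbb{R}^n$. Define $\phi_A(T,S)=t_{1_A}e_{1_A}+\cdots+t_{q_A}e_{q_A}+s_1v_1+\cdots+s_dv_d$ for $T=(t_{1_A},\dots,t_{q_A})\in[0,1]^q$, $S=(s_1,\dots,s_d)\in[0,1]^d$ (points of $\mathbb{R}^n$ are projected to $\mathbb{T}^n$), and let $k_{i_A}=k\cdot e_{i_A}$. When $R_{d,A}f\in L^1(\mathbb{T}^n)$, it satisfies $R_{d,A}f(x+s_1v_1+\cdots+s_dv_d)=R_{d,A}f(x)$ for a.e. $x$ and every $S\in\mathbb{R}^d$; the values $R_{d,A}f(\phi_A(T,0))$ (for a.e. $T$) refer to a representative invariant under these translations. *)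

theory Defs
  imports "HOL-Analysis.Analysis"
begin

text \<open>
  The torus \<open>\<real>\<^sup>n/\<int>\<^sup>n\<close> is handled through the \<open>\<int>\<^sup>n\<close>-periodic functions on \<^typ>\<open>real^'n\<close>, and
  an integral over the torus is an integral over the unit cube \<^term>\<open>cbox 0 1 :: (real^'n) set\<close>
  (\<^term>\<open>1 :: real^'n\<close> is the vector all of whose entries are 1).
\<close>

definition rvec :: "int^'n \<Rightarrow> real^'n" where
  "rvec k = (\<chi> i. of_int (k $ i))"

definition qvec :: "int^'n \<Rightarrow> rat^'n" where
  "qvec k = (\<chi> i. of_int (k $ i))"

definition periodic :: "(real^'n \<Rightarrow> complex) \<Rightarrow> bool" where
  "periodic g \<longleftrightarrow> (\<forall>x m. g (x + rvec m) = g x)"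

definition partial :: "'n \<Rightarrow> (real^'n \<Rightarrow> complex) \<Rightarrow> real^'n \<Rightarrow> complex" where
  "partial i g x = vector_derivative (\<lambda>t. g (x + t *\<^sub>R axis i 1)) (at 0)"

abbreviation partials :: "'n list \<Rightarrow> (real^'n \<Rightarrow> complex) \<Rightarrow> real^'n \<Rightarrow> complex" where
  "partials \<alpha> g \<equiv> foldr partial \<alpha> g"

definition smooth :: "(real^'n \<Rightarrow> complex) \<Rightarrow> bool" where
  "smooth g \<longleftrightarrow> (\<forall>\<alpha> x. partials \<alpha> g differentiable (at x))"

definition test_functions :: "(real^'n \<Rightarrow> complex) set" where
  "test_functions = {g. smooth g \<and> periodic g}"

text \<open>The Frechet topology of uniform convergence of all derivatives.\<close>

definition test_near :: "nat \<Rightarrow> real \<Rightarrow> (real^'n \<Rightarrow> complex) \<Rightarrow> (real^'n \<Rightarrow> complex) \<Rightarrow> bool" where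
  "test_near N \<epsilon> g h \<longleftrightarrow>
     (\<forall>\<alpha> x. length \<alpha> \<le> N \<longrightarrow> cmod (partials \<alpha> h x - partials \<alpha> g x) < \<epsilon>)"

definition test_open :: "(real^'n \<Rightarrow> complex) set \<Rightarrow> bool" where
  "test_open U \<longleftrightarrow> U \<subseteq> test_functions \<and>
     (\<forall>g\<in>U. \<exists>N. \<exists>\<epsilon>>0. \<forall>h\<in>test_functions. test_near N \<epsilon> g h \<longrightarrow> h \<in> U)"

definition test_topology :: "(real^'n \<Rightarrow> complex) topology" where
  "test_topology = topology test_open"

lemma istopology_test_open: "istopology (test_open :: (real^'n \<Rightarrow> complex) set \<Rightarrow> bool)"
  unfolding istopology_def
proof (intro conjI allI impI)
  fix U V :: "(real^'n \<Rightarrow> complex) set"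
  assume U: "test_open U" and V: "test_open V"
  show "test_open (U \<inter> V)"
    unfolding test_open_def
  proof (intro conjI ballI)
    show "U \<inter> V \<subseteq> test_functions"
      using U by (auto simp: test_open_def)
  next
    fix g assume g: "g \<in> U \<inter> V"
    from U g obtain N1 e1 where 1: "e1 > 0"
      "\<And>h. h \<in> test_functions \<Longrightarrow> test_near N1 e1 g h \<Longrightarrow> h \<in> U"
      unfolding test_open_def by blast
    from V g obtain N2 e2 where 2: "e2 > 0"
      "\<And>h. h \<in> test_functions \<Longrightarrow> test_near N2 e2 g h \<Longrightarrow> h \<in> V"
      unfolding test_open_def by blast
    have "h \<in> U \<inter> V"
      if "h \<in> test_functions" "test_near (max N1 N2) (min e1 e2) g h" for h
    proof -
      have "test_near N1 e1 g h" "test_near N2 e2 g h"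
        using that(2) by (auto simp: test_near_def)
      then show ?thesis using 1 2 that(1) by blast
    qed
    then show "\<exists>N. \<exists>\<epsilon>>0. \<forall>h\<in>test_functions. test_near N \<epsilon> g h \<longrightarrow> h \<in> U \<inter> V"
      using 1(1) 2(1) by (intro exI[of _ "max N1 N2"] exI[of _ "min e1 e2"]) auto
  qed
next
  fix K :: "(real^'n \<Rightarrow> complex) set set"
  assume K: "\<forall>U\<in>K. test_open U"
  show "test_open (\<Union>K)"
    unfolding test_open_def
  proof (intro conjI ballI)
    show "\<Union>K \<subseteq> test_functions"
      using K by (auto simp: test_open_def)
  next
    fix g assume "g \<in> \<Union>K"
    then obtain U where U: "U \<in> K" "g \<in> U" by blast
    then obtain N e where "e > 0"
      "\<forall>h\<in>test_functions. test_near N e g h \<longrightarrow> h \<in> U"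
      using K unfolding test_open_def by blast
    then show "\<exists>N. \<exists>\<epsilon>>0. \<forall>h\<in>test_functions. test_near N \<epsilon> g h \<longrightarrow> h \<in> \<Union>K"
      using U(1) by blast
  qed
qed

lemma openin_test_topology: "openin test_topology = test_open"
  unfolding test_topology_def using istopology_test_open by (rule topology_inverse')

lemma topspace_test_topology: "topspace test_topology = test_functions"
proof -
  have "test_open test_functions"
    unfolding test_open_def by (auto intro!: exI[of _ "1::real"])
  moreover have "U \<subseteq> test_functions" if "test_open U" for U
    using that by (simp add: test_open_def)
  ultimately show ?thesis
    unfolding topspace_def openin_test_topology by blast
qed

text \<open>
  A distribution \<open>u\<close> is a functional whose value \<open>u g\<close> is the pairing \<open>(u, g)\<close>; only its values on
  \<^const>\<open>test_functions\<close> are meaningful. The pairing is bilinear, without conjugation.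
\<close>

definition distributions :: "((real^'n \<Rightarrow> complex) \<Rightarrow> complex) set" where
  "distributions = {u.
     (\<forall>g\<in>test_functions. \<forall>h\<in>test_functions. u (\<lambda>x. g x + h x) = u g + u h) \<and>
     (\<forall>c. \<forall>g\<in>test_functions. u (\<lambda>x. c * g x) = c * u g) \<and>
     continuous_map test_topology euclidean u}"

definition fourier_coeff :: "((real^'n \<Rightarrow> complex) \<Rightarrow> complex) \<Rightarrow> int^'n \<Rightarrow> complex" where
  "fourier_coeff u k = u (\<lambda>x. exp (- 2 * of_real pi * \<i> * of_real (rvec k \<bullet> x)))"

definition torus_L1 :: "(real^'n \<Rightarrow> complex) set" where
  "torus_L1 = {F. periodic F \<and> set_integrable lebesgue (cbox 0 1) F}"

definition dist_of_fun :: "(real^'n \<Rightarrow> complex) \<Rightarrow> (real^'n \<Rightarrow> complex) \<Rightarrow> complex" where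
  "dist_of_fun F g = (LINT x:cbox 0 1|lebesgue. F x * g x)"

definition Gr :: "nat \<Rightarrow> (rat^'n) set set" where
  "Gr d = {A. vec.subspace A \<and> vec.dim A = d}"

definition perp :: "int^'n \<Rightarrow> (rat^'n) set \<Rightarrow> bool" where
  "perp k A \<longleftrightarrow> (\<forall>v\<in>A. (\<Sum>i\<in>UNIV. of_int (k $ i) * v $ i) = 0)"

definition represents :: "('d::finite \<Rightarrow> int^'n) \<Rightarrow> (rat^'n) set \<Rightarrow> bool" where
  "represents v A \<longleftrightarrow> inj v \<and> vec.independent (range (\<lambda>j. qvec (v j))) \<and>
     vec.span (range (\<lambda>j. qvec (v j))) = A"

definition comb :: "('d::finite \<Rightarrow> int^'n) \<Rightarrow> real^'d \<Rightarrow> real^'n" where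
  "comb v s = (\<Sum>j\<in>UNIV. (s $ j) *\<^sub>R rvec (v j))"

definition radon :: "('d::finite \<Rightarrow> int^'n) \<Rightarrow> (real^'n \<Rightarrow> complex) \<Rightarrow> real^'n \<Rightarrow> complex" where
  "radon v g x = (LINT t:cbox 0 1|lebesgue. g (x + comb v t))"

definition radon_dist ::
  "('d::finite \<Rightarrow> int^'n) \<Rightarrow> ((real^'n \<Rightarrow> complex) \<Rightarrow> complex) \<Rightarrow> (real^'n \<Rightarrow> complex) \<Rightarrow> complex" where
  "radon_dist v u g = u (radon v g)"

text \<open>The family \<open>e\<close> selects indices; the standard unit vectors themselves are \<open>axis (e i) 1\<close>.\<close>

definition complementary_axes :: "('d::finite \<Rightarrow> int^'n) \<Rightarrow> ('q::finite \<Rightarrow> 'n) \<Rightarrow> bool" where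
  "complementary_axes v e \<longleftrightarrow> inj e \<and>
     (\<forall>i. (axis (e i) 1 :: real^'n) \<notin> span (range (\<lambda>j. rvec (v j)))) \<and>
     span (range (\<lambda>j. rvec (v j)) \<union> range (\<lambda>i. axis (e i) 1)) = (UNIV :: (real^'n) set)"

definition phi ::
  "('d::finite \<Rightarrow> int^'n) \<Rightarrow> ('q::finite \<Rightarrow> 'n) \<Rightarrow> real^'q \<Rightarrow> real^'d \<Rightarrow> real^'n" where
  "phi v e T S = (\<Sum>i\<in>UNIV. (T $ i) *\<^sub>R axis (e i) 1) + comb v S"

end

theory Submission imports Defs
begin

text \<open>
  The character \<open>\<chi>(x) = exp (-2\<pi>i k \<bullet> x)\<close> is constant along \<open>A\<close>, so it is its own Radon transform and
  \<open>f\<close> has the same \<open>k\<close>-th Fourier coefficient as its Radon transform: it is the integral over the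
  unit cube of \<open>F = R\<^sub>d f \<cdot> \<chi>\<close>, a periodic function invariant under translations by the real span \<open>V\<close>
  of \<open>A\<close>. Let \<open>T\<close> be the coordinates along the chosen axes and \<open>y\<close> the remaining ones. Modulo \<open>V\<close>, the
  point with coordinates \<open>(T, y)\<close> agrees with the point with coordinates \<open>(T + b y, 0)\<close> for some \<open>b y\<close>,
  so \<open>F (T, y) = G (T + b y)\<close>, where \<open>G\<close> is the restriction of \<open>F\<close> to the chosen axes. By Fubini, the
  integral of \<open>F\<close> is the average over \<open>y\<close> of integrals of translates of the periodic function \<open>G\<close>, all
  of which equal the integral of \<open>G\<close>. In particular no Jacobian of \<open>\<phi>\<^sub>A\<close> enters.
\<close>

subsection \<open>Characters of the torus\<close>

definition character :: "int^'n \<Rightarrow> real^'n \<Rightarrow> complex" where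
  "character k x = exp (- 2 * of_real pi * \<i> * of_real (rvec k \<bullet> x))"

lemma character_add: "character k (x + y) = character k x * character k y"
  by (simp add: character_def inner_add_right exp_add [symmetric] algebra_simps)

lemma rvec_inner: "rvec k \<bullet> rvec m = of_int (\<Sum>i\<in>UNIV. k $ i * m $ i)"
  by (simp add: rvec_def inner_vec_def)

lemma character_rvec [simp]: "character k (rvec m) = 1"
proof -
  have "character k (rvec m) = exp (of_int (2 * (- (\<Sum>i\<in>UNIV. k $ i * m $ i))) * of_real pi * \<i>)"
    unfolding character_def rvec_inner by (simp add: algebra_simps)
  also have "\<dots> = 1"
    unfolding exp_eq_1 by (intro conjI exI[of _ "- (\<Sum>i\<in>UNIV. k $ i * m $ i)"]) simp_all
  finally show ?thesis .
qed

lemma periodic_character: "periodic (character k)"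
  by (simp add: periodic_def character_add)

lemma character_differentiable: "character k differentiable (at x)"
proof -
  have "((\<lambda>x. of_real (rvec k \<bullet> x) :: complex) has_derivative (\<lambda>y. of_real (rvec k \<bullet> y))) (at x)"
    by (auto intro!: derivative_eq_intros)
  then have "(\<lambda>x. - 2 * of_real pi * \<i> * of_real (rvec k \<bullet> x) :: complex) differentiable (at x)"
    by (intro differentiable_mult) (auto intro: differentiableI)
  then obtain D where
      "((\<lambda>x. - 2 * of_real pi * \<i> * of_real (rvec k \<bullet> x) :: complex) has_derivative D) (at x)"
    unfolding differentiable_def by blast
  from has_derivative_compose [OF this DERIV_exp [THEN has_field_derivative_imp_has_derivative]]
  show ?thesis
    unfolding character_def [abs_def] by (rule differentiableI)
qed

text \<open>The scalar \<open>c\<close> makes the shape stable under differentiation, so that the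
  rule can be iterated over a list of directions.\<close>

lemma partial_character:
  "partial i (\<lambda>x. c * character k x) =
     (\<lambda>x. (c * (- 2 * of_real pi * \<i> * of_int (k $ i))) * character k x)"
proof
  fix x
  let ?a = "- 2 * of_real pi * \<i> * of_int (k $ i) :: complex"
  have eq: "c * character k (x + t *\<^sub>R axis i 1) = (c * character k x) * exp (of_real t * ?a)" for t
    unfolding character_add
    by (simp add: character_def rvec_def inner_axis mult_ac)
  have "((\<lambda>t. (c * character k x) * exp (of_real t * ?a)) has_vector_derivative
      (c * character k x) * ?a) (at 0)"
    by (rule has_vector_derivative_real_field) (auto intro!: derivative_eq_intros)
  then show "partial i (\<lambda>x. c * character k x) x = c * ?a * character k x"
    unfolding partial_def eq by (simp add: vector_derivative_at mult_ac)
qed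

text \<open>The scalar stays existential: smoothness asks only that each iterated derivative be
  differentiable, and its value never matters.\<close>

lemma partials_character: "\<exists>c. partials \<alpha> (character k) = (\<lambda>x. c * character k x)"
proof (induction \<alpha>)
  case Nil
  show ?case by (rule exI [of _ 1]) simp
next
  case (Cons i \<alpha>)
  then obtain c where "partials \<alpha> (character k) = (\<lambda>x. c * character k x)"
    by blast
  then have "partials (i # \<alpha>) (character k) = partial i (\<lambda>x. c * character k x)"
    by simp
  then show ?case
    unfolding partial_character by (rule exI)
qed

lemma character_test_function: "character k \<in> test_functions"
proof -
  have "partials \<alpha> (character k) differentiable (at x)" for \<alpha> x
  proof -
    obtain c where "partials \<alpha> (character k) = (\<lambda>x. c * character k x)"
      using partials_character by blast
    then show ?thesis
      by (simp add: character_differentiable)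
  qed
  then show ?thesis
    by (simp add: test_functions_def smooth_def periodic_character)
qed

subsection \<open>Integrals with respect to a completed measure\<close>

lemma complex_AE_borel:
  fixes f :: "'a \<Rightarrow> complex"
  assumes "f \<in> borel_measurable (completion M)"
  obtains g where "g \<in> borel_measurable M" "AE x in M. f x = g x"
proof -
  have "(\<lambda>x. Re (f x)) \<in> borel_measurable (completion M)" "(\<lambda>x. Im (f x)) \<in> borel_measurable (completion M)"
    using assms by simp_all
  from this [THEN completion_ex_borel_measurable_real]
  obtain a b where ab: "a \<in> borel_measurable M" "b \<in> borel_measurable M"
      "AE x in M. Re (f x) = a x" "AE x in M. Im (f x) = b x"
    by blast
  show thesis
  proof
    show "(\<lambda>x. Complex (a x) (b x)) \<in> borel_measurable M"
      unfolding borel_measurable_complex_iff using ab by simp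
    show "AE x in M. f x = Complex (a x) (b x)"
      using ab(3,4) by eventually_elim (simp add: complex_eq_iff)
  qed
qed

text \<open>Product measures and Fubini live on Borel sets while the integrals in the theorem are
  Lebesgue integrals. This is the way down from the completed measure: replace the integrand by a
  measurable function equal to it almost everywhere.\<close>

lemma has_bochner_integral_completion_imp:
  fixes f :: "'a \<Rightarrow> complex"
  assumes "has_bochner_integral (completion M) f I"
  obtains g where "has_bochner_integral M g I" "AE x in M. f x = g x"
proof -
  have f: "f \<in> borel_measurable (completion M)"
    using assms by (auto elim: has_bochner_integral.cases)
  then obtain g where g: "g \<in> borel_measurable M" "AE x in M. f x = g x"
    by (rule complex_AE_borel)
  have "has_bochner_integral (completion M) g I"
    using assms has_bochner_integral_cong_AE [OF f measurable_completion [OF g(1)] AE_completion [OF g(2)]]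
    by simp
  then have "has_bochner_integral M g I"
    using g(1) by (simp add: has_bochner_integral_iff integrable_completion integral_completion)
  with g(2) that show thesis by blast
qed

text \<open>The way back up. Measurability of \<open>f\<close> is not assumed but follows from that
  of \<open>g\<close>, because Lebesgue measure is complete.\<close>

lemma has_bochner_integral_lebesgue_AE:
  fixes f g :: "'a::euclidean_space \<Rightarrow> 'b::euclidean_space"
  assumes int: "has_bochner_integral lebesgue g I" and "AE x in lborel. f x = g x"
  shows "has_bochner_integral lebesgue f I"
proof -
  have g: "g \<in> borel_measurable lebesgue"
    using assms by (auto elim: has_bochner_integral.cases)
  have AE: "AE x in lebesgue. f x = g x"
    using assms(2) by (rule AE_completion)
  then have "AE x in lebesgue. g x = f x"
    by eventually_elim simp
  then have f: "f \<in> borel_measurable lebesgue"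
    by (rule borel_measurable_AE [OF g])
  show ?thesis
    using has_bochner_integral_cong_AE [OF f g AE] int by simp
qed

lemma has_bochner_integral_completion:
  fixes f :: "'a \<Rightarrow> 'b::{banach, second_countable_topology}"
  assumes "has_bochner_integral M f I"
  shows "has_bochner_integral (completion M) f I"
proof -
  have f: "f \<in> borel_measurable M"
    using assms by (auto elim: has_bochner_integral.cases)
  show ?thesis
    using assms by (simp add: has_bochner_integral_iff integrable_completion [OF f] integral_completion [OF f])
qed

text \<open>Translation is the coordinatewise affine map with all scaling factors equal to 1, so its
  density factor is 1.\<close>

lemma
  fixes a :: "'a::euclidean_space"
  shows lebesgue_measurable_translate: "(\<lambda>x. x + a) \<in> lebesgue \<rightarrow>\<^sub>M lebesgue"
    and lebesgue_distr_translate: "distr lebesgue lebesgue (\<lambda>x. x + a) = lebesgue"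
proof -
  have eq: "(\<lambda>x. a + (\<Sum>j\<in>Basis. (1 * (x \<bullet> j)) *\<^sub>R j)) = (\<lambda>x. x + a)"
    by (simp add: euclidean_representation add.commute)
  show "(\<lambda>x. x + a) \<in> lebesgue \<rightarrow>\<^sub>M lebesgue"
    using lebesgue_affine_measurable [of "\<lambda>_. 1" a] unfolding eq by simp
  show "distr lebesgue lebesgue (\<lambda>x. x + a) = lebesgue"
    using lebesgue_affine_euclidean [of "\<lambda>_. 1" a] unfolding eq by (simp add: density_1)
qed

lemma has_bochner_integral_lebesgue_translate:
  fixes f :: "'a::euclidean_space \<Rightarrow> 'b::{banach, second_countable_topology}"
  assumes "has_bochner_integral lebesgue f I"
  shows "has_bochner_integral lebesgue (\<lambda>x. f (x + a)) I"
proof -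
  have f: "f \<in> borel_measurable lebesgue"
    using assms by (auto elim: has_bochner_integral.cases)
  have distr: "has_bochner_integral (distr lebesgue lebesgue (\<lambda>x. x + a)) f I"
    unfolding lebesgue_distr_translate by (rule assms)
  then show ?thesis
    using integrable_distr_eq [OF lebesgue_measurable_translate f, of a]
      integral_distr [OF lebesgue_measurable_translate f, of a]
    unfolding has_bochner_integral_iff by metis
qed

subsection \<open>Translation invariance for periodic functions\<close>

text \<open>An exact fundamental domain for the integer lattice: unlike the closed cube, it contains
  one and only one integer translate of every point.\<close>

definition half_open_cube :: "(real^'n) set" where
  "half_open_cube = {x. \<forall>i. 0 \<le> x $ i \<and> x $ i < 1}"

lemma half_open_cube_lebesgue [measurable]: "(half_open_cube :: (real^'n) set) \<in> sets lebesgue"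
proof -
  have "(half_open_cube :: (real^'n) set) = (\<Inter>i. {x::real^'n. 0 \<le> x $ i} \<inter> {x. x $ i < 1})"
    by (auto simp: half_open_cube_def)
  also have "\<dots> \<in> sets borel"
    by (intro sets.countable_INT'' sets.Int borel_closed borel_open
          closed_halfspace_component_ge_cart open_halfspace_component_lt_cart) auto
  finally show ?thesis
    by (simp add: sets_completionI_sets)
qed

lemma integer_box_finite: "finite {m :: int^'n. \<forall>i. \<bar>m $ i\<bar> \<le> N}"
proof (rule finite_subset)
  show "{m :: int^'n. \<forall>i. \<bar>m $ i\<bar> \<le> N} \<subseteq> vec_lambda ` (UNIV \<rightarrow>\<^sub>E {-N..N})"
  proof
    fix m :: "int^'n"
    assume "m \<in> {m. \<forall>i. \<bar>m $ i\<bar> \<le> N}"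
    then have "vec_nth m \<in> UNIV \<rightarrow>\<^sub>E {-N..N}"
      by (auto simp: abs_le_iff) (smt (verit))
    then show "m \<in> vec_lambda ` (UNIV \<rightarrow>\<^sub>E {-N..N})"
      by (metis image_eqI vec_nth_inverse)
  qed
qed (simp add: finite_PiE)

text \<open>The only integer vector moving \<open>y\<close> into the cube is the negated
  componentwise floor. As \<open>N\<close> is an integer, taking floors keeps the components within
  the bound, so this vector is among the summands.\<close>

lemma sum_cube_translates:
  fixes y :: "real^'n"
  assumes "\<And>i. \<bar>y $ i\<bar> \<le> of_int N"
  shows "(\<Sum>m\<in>{m. \<forall>i. \<bar>m $ i\<bar> \<le> N}. indicator half_open_cube (y + rvec m) :: real) = 1"
proof -
  let ?m = "(\<chi> i. - \<lfloor>y $ i\<rfloor>) :: int^'n"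
  have "y + rvec m \<in> half_open_cube \<longleftrightarrow> m = ?m" for m
  proof -
    have "0 \<le> y $ i + of_int (m $ i) \<and> y $ i + of_int (m $ i) < 1 \<longleftrightarrow> m $ i = - \<lfloor>y $ i\<rfloor>" for i
      by linarith
    then show ?thesis
      by (simp add: half_open_cube_def rvec_def vec_eq_iff)
  qed
  then have "(\<Sum>m\<in>{m. \<forall>i. \<bar>m $ i\<bar> \<le> N}. indicator half_open_cube (y + rvec m) :: real) =
      (\<Sum>m\<in>{m. \<forall>i. \<bar>m $ i\<bar> \<le> N}. if m = ?m then 1 else 0)"
    by (intro sum.cong) (auto simp: indicator_def)
  also have "\<dots> = 1"
  proof -
    have "\<bar>\<lfloor>y $ i\<rfloor>\<bar> \<le> N" for i
      using assms [of i] by linarith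
    then have "?m \<in> {m. \<forall>i. \<bar>m $ i\<bar> \<le> N}"
      by simp
    then show ?thesis
      by (simp add: integer_box_finite)
  qed
  finally show ?thesis .
qed

text \<open>Cut the cube along the lattice translates of its shift by \<open>a\<close>, move every
  piece by an integer vector, which periodicity does not notice, and reassemble. The finite range
  \<open>M\<close> of integer vectors keeps all sums finite.\<close>

lemma periodic_cube_translate:
  fixes G :: "real^'n \<Rightarrow> complex"
  assumes per: "periodic G"
    and G: "has_bochner_integral lebesgue (\<lambda>x. indicator half_open_cube x *\<^sub>R G x) I"
  shows "has_bochner_integral lebesgue (\<lambda>x. indicator half_open_cube x *\<^sub>R G (x + a)) I"
proof -
  let ?C = "half_open_cube :: (real^'n) set"
  \<comment> \<open>The sum of the ceilings dominates each single one; the extra 1 covers the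
    coordinates of a point of the cube, so that both \<open>x - a\<close> and \<open>x + a\<close>
    stay within \<open>N\<close>.\<close>
  define N where "N = (\<Sum>i\<in>UNIV. \<lceil>\<bar>a $ i\<bar>\<rceil>) + 1"
  define M where "M = {m :: int^'n. \<forall>i. \<bar>m $ i\<bar> \<le> N}"
  \<comment> \<open>the sets \<open>?C \<inter> (?C + a - m)\<close> partition \<open>?C\<close>, and moved by \<open>m - a\<close> they partition \<open>?C\<close> again\<close>
  define h where "h m x = (indicator ?C x * indicator ?C (x - a + rvec m)) *\<^sub>R G x" for m x
  have a_bound: "\<bar>a $ i\<bar> + 1 \<le> of_int N" for i
  proof -
    have "\<lceil>\<bar>a $ i\<bar>\<rceil> \<le> (\<Sum>i\<in>UNIV. \<lceil>\<bar>a $ i\<bar>\<rceil>)"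
      by (rule member_le_sum) auto
    then show ?thesis
      unfolding N_def by linarith
  qed
  have bound: "\<bar>(x - a) $ i\<bar> \<le> of_int N" "\<bar>(x + a) $ i\<bar> \<le> of_int N" if "x \<in> ?C" for x i
    using that a_bound [of i] unfolding half_open_cube_def
    by (simp_all add: abs_le_iff) (smt (verit))+
  have "integrable lebesgue (h m)" for m
  proof (rule Bochner_Integration.integrable_bound)
    show "integrable lebesgue (\<lambda>x. indicator ?C x *\<^sub>R G x)"
      using G by (simp add: has_bochner_integral_iff)
    then have "(\<lambda>x. indicator ?C x *\<^sub>R G x) \<in> borel_measurable lebesgue"
      by simp
    moreover have "(\<lambda>x. x - a + rvec m) \<in> lebesgue \<rightarrow>\<^sub>M lebesgue"
      using lebesgue_measurable_translate [of "rvec m - a"] by (simp add: algebra_simps)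
    ultimately have "(\<lambda>x. indicator ?C (x - a + rvec m) *\<^sub>R (indicator ?C x *\<^sub>R G x)) \<in> borel_measurable lebesgue"
      by measurable
    then show "h m \<in> borel_measurable lebesgue"
      unfolding h_def [abs_def] by (simp add: mult_ac)
    show "AE x in lebesgue. norm (h m x) \<le> norm (indicator ?C x *\<^sub>R G x)"
      by (auto simp: h_def indicator_def)
  qed
  then have h: "has_bochner_integral lebesgue (h m) (integral\<^sup>L lebesgue (h m))" for m
    by (simp add: has_bochner_integral_iff)
  have h_sum: "(\<Sum>m\<in>M. h m x) = indicator ?C x *\<^sub>R G x" for x
  proof (cases "x \<in> ?C")
    case True
    then have "(\<Sum>m\<in>M. indicator ?C (x - a + rvec m) :: real) = 1"
      unfolding M_def by (intro sum_cube_translates bound)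
    with True show ?thesis
      by (simp add: h_def flip: scaleR_left.sum)
  qed (simp add: h_def)
  have "has_bochner_integral lebesgue (\<lambda>x. \<Sum>m\<in>M. h m x) (\<Sum>m\<in>M. integral\<^sup>L lebesgue (h m))"
    by (intro has_bochner_integral_sum h)
  then have I: "(\<Sum>m\<in>M. integral\<^sup>L lebesgue (h m)) = I"
    using G unfolding h_sum by (rule has_bochner_integral_eq)
  \<comment> \<open>With index \<open>- m\<close> and shift \<open>a + rvec m\<close>, the argument
    of the second indicator in \<open>h\<close> collapses to \<open>x\<close>, while the first
    becomes the translate of \<open>x + a\<close> by \<open>rvec m\<close>.\<close>
  have "has_bochner_integral lebesgue (\<lambda>x. h (- m) (x + (a + rvec m))) (integral\<^sup>L lebesgue (h (- m)))" for m
    by (rule has_bochner_integral_lebesgue_translate [OF h])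
  moreover have "rvec (- m) = - rvec m" for m :: "int^'n"
    by (simp add: rvec_def vec_eq_iff)
  moreover have "G (x + (a + rvec m)) = G (x + a)" for x m
    using per unfolding periodic_def by (metis add.assoc)
  ultimately have "has_bochner_integral lebesgue
      (\<lambda>x. (indicator ?C (x + a + rvec m) * indicator ?C x) *\<^sub>R G (x + a))
      (integral\<^sup>L lebesgue (h (- m)))" for m
    by (simp add: h_def algebra_simps)
  then have "has_bochner_integral lebesgue
      (\<lambda>x. \<Sum>m\<in>M. (indicator ?C (x + a + rvec m) * indicator ?C x) *\<^sub>R G (x + a))
      (\<Sum>m\<in>M. integral\<^sup>L lebesgue (h (- m)))"
    by (rule has_bochner_integral_sum)
  moreover have "(\<Sum>m\<in>M. (indicator ?C (x + a + rvec m) * indicator ?C x) *\<^sub>R G (x + a)) =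
      indicator ?C x *\<^sub>R G (x + a)" for x
  proof (cases "x \<in> ?C")
    case True
    then have "(\<Sum>m\<in>M. indicator ?C (x + a + rvec m) :: real) = 1"
      unfolding M_def by (intro sum_cube_translates bound)
    with True show ?thesis
      by (simp flip: scaleR_left.sum)
  qed simp
  \<comment> \<open>\<open>M\<close> is symmetric about 0.\<close>
  moreover have "(\<Sum>m\<in>M. integral\<^sup>L lebesgue (h (- m))) = (\<Sum>m\<in>M. integral\<^sup>L lebesgue (h m))"
    by (rule sum.reindex_bij_witness [of _ uminus uminus]) (auto simp: M_def)
  ultimately show ?thesis
    unfolding I by simp
qed

text \<open>Both cubes lie between the open box and its closure, so they differ only on a negligible
  frontier.\<close>

lemma AE_half_open_cube:
  "AE x in lborel. x \<in> half_open_cube \<longleftrightarrow> x \<in> cbox 0 (1 :: real^'n)"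
proof -
  have "cbox 0 1 - box 0 (1::real^'n) \<in> null_sets lborel"
    using negligible_frontier_interval [of 0 "1::real^'n"]
    by (simp add: negligible_iff_null_sets null_sets_completion_iff)
  then have "AE x in lborel. x \<notin> cbox 0 1 - box 0 (1::real^'n)"
    by (rule AE_not_in)
  then show ?thesis
    by eventually_elim (auto simp: half_open_cube_def mem_box_cart less_imp_le)
qed

lemma emeasure_unit_cube: "emeasure lborel (cbox 0 (1 :: real^'n)) = 1"
proof -
  have "(1 :: real^'n) \<bullet> b = 1" if "b \<in> Basis" for b
    using that by (auto simp: Basis_vec_def inner_axis)
  then show ?thesis
    by (simp add: emeasure_lborel_cbox_eq)
qed

subsection \<open>Fubini along a partition of the coordinates\<close>

definition axes_comb :: "('q::finite \<Rightarrow> 'n) \<Rightarrow> real^'q \<Rightarrow> real^'n" where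
  "axes_comb e T = (\<Sum>i\<in>UNIV. (T $ i) *\<^sub>R axis (e i) 1)"

lemma axes_comb_nth: "inj e \<Longrightarrow> axes_comb e T $ e i = T $ i"
  by (simp add: axes_comb_def axis_def inj_eq if_distrib [of "\<lambda>x. _ * x"] cong: if_cong)

lemma axes_comb_nth_0: "l \<notin> range e \<Longrightarrow> axes_comb e T $ l = 0"
  by (auto simp: axes_comb_def axis_def intro!: sum.neutral)

lemma linear_axes_comb: "linear (axes_comb e)"
  by (rule linearI)
     (simp_all add: axes_comb_def scaleR_add_left sum.distrib scaleR_right.sum)

lemma prod_Basis_cart:
  "(\<Prod>b\<in>(Basis :: (real^'n) set). f b) = (\<Prod>i\<in>UNIV. f (axis i 1))"
proof -
  have eq: "(Basis :: (real^'n) set) = range (\<lambda>i. axis i 1)"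
    by (auto simp: Basis_vec_def)
  have "inj (\<lambda>i. axis i 1 :: real^'n)"
    by (simp add: inj_def axis_eq_axis)
  then show ?thesis
    unfolding eq by (subst prod.reindex) (simp_all add: o_def)
qed

lemma emeasure_lborel_box_cart:
  fixes l u :: "real^'n"
  assumes "\<And>i. l $ i \<le> u $ i"
  shows "emeasure lborel (box l u) = ennreal (\<Prod>i\<in>UNIV. (u - l) $ i)"
proof -
  have "l \<bullet> b \<le> u \<bullet> b" if "b \<in> Basis" for b
    using that assms by (auto simp: Basis_vec_def inner_axis)
  then show ?thesis
    by (simp add: emeasure_lborel_box prod_Basis_cart inner_axis)
qed

text \<open>The coordinates to be averaged over come first in the pair, which makes them the outer
  variable in Fubini's theorem.\<close>

definition join :: "('q::finite \<Rightarrow> 'n) \<Rightarrow> ('d::finite \<Rightarrow> 'n) \<Rightarrow> (real^'d) \<times> (real^'q) \<Rightarrow> real^'n" where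
  "join e e' p = axes_comb e (snd p) + axes_comb e' (fst p)"

lemma borel_measurable_join [measurable]: "join e e' \<in> borel_measurable (lborel \<Otimes>\<^sub>M lborel)"
proof -
  have "linear (join e e')"
    unfolding join_def [abs_def]
    using linear_compose_add linear_compose [OF linear_snd linear_axes_comb]
      linear_compose [OF linear_fst linear_axes_comb] by (fastforce simp: o_def)
  then have "join e e' \<in> borel_measurable borel"
    by (intro borel_measurable_continuous_onI linear_continuous_on linear_conv_bounded_linear [THEN iffD1])
  then show ?thesis
    by (simp add: lborel_prod)
qed

locale coordinate_partition =
  fixes e :: "'q::finite \<Rightarrow> 'n::finite" and e' :: "'d::finite \<Rightarrow> 'n"
  assumes inj: "inj e" "inj e'"
    and disjoint: "range e \<inter> range e' = {}"
    and cover: "range e \<union> range e' = UNIV"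
begin

lemma all_split: "(\<forall>l. P l) \<longleftrightarrow> (\<forall>j. P (e' j)) \<and> (\<forall>i. P (e i))"
  using cover by (metis UNIV_I Un_iff rangeE)

lemma join_nth: "join e e' (y, T) $ e i = T $ i" "join e e' (y, T) $ e' j = y $ j"
proof -
  have "e i \<notin> range e'" "e' j \<notin> range e"
    using disjoint by auto
  then show "join e e' (y, T) $ e i = T $ i" "join e e' (y, T) $ e' j = y $ j"
    using inj by (simp_all add: join_def axes_comb_nth axes_comb_nth_0)
qed

lemma join_half_open_cube:
  "join e e' (y, T) \<in> half_open_cube \<longleftrightarrow> y \<in> half_open_cube \<and> T \<in> half_open_cube"
  unfolding half_open_cube_def mem_Collect_eq
  by (subst all_split) (simp add: join_nth)

text \<open>\<open>join\<close> merely rearranges coordinates: the preimage of a box is a product of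
  two boxes, and the product of all side lengths regroups accordingly. Agreement on boxes determines
  \<open>lborel\<close>.\<close>

lemma distr_join: "distr (lborel \<Otimes>\<^sub>M lborel) borel (join e e') = lborel"
proof (rule lborel_eqI [symmetric])
  fix l u :: "real^'n"
  assume le: "\<And>b. b \<in> Basis \<Longrightarrow> l \<bullet> b \<le> u \<bullet> b"
  have le': "l $ i \<le> u $ i" for i
    using le [of "axis i 1"] by (simp add: inner_axis axis_in_Basis_iff)
  define B where "B = box (\<chi> j. l $ e' j) (\<chi> j. u $ e' j)"
  define C where "C = box (\<chi> i. l $ e i) (\<chi> i. u $ e i)"
  have eq: "join e e' -` box l u = B \<times> C"
  proof -
    have "join e e' (y, T) \<in> box l u \<longleftrightarrow> y \<in> B \<and> T \<in> C" for y T
      unfolding B_def C_def mem_box_cart by (subst all_split) (simp add: join_nth)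
    then show ?thesis by auto
  qed
  have B: "emeasure lborel B = (\<Prod>j\<in>UNIV. (u - l) $ e' j)"
    unfolding B_def using le' by (subst emeasure_lborel_box_cart) simp_all
  have C: "emeasure lborel C = (\<Prod>i\<in>UNIV. (u - l) $ e i)"
    unfolding C_def using le' by (subst emeasure_lborel_box_cart) simp_all
  have "emeasure (distr (lborel \<Otimes>\<^sub>M lborel) borel (join e e')) (box l u) =
      emeasure (lborel \<Otimes>\<^sub>M lborel) (B \<times> C)"
    by (subst emeasure_distr) (simp_all add: eq space_pair_measure)
  also have "\<dots> = emeasure lborel B * emeasure lborel C"
    by (rule lborel.emeasure_pair_measure_Times) (simp_all add: B_def C_def)
  also have "\<dots> = ennreal ((\<Prod>j\<in>UNIV. (u - l) $ e' j) * (\<Prod>i\<in>UNIV. (u - l) $ e i))"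
    unfolding B C using le' by (intro ennreal_mult [symmetric] prod_nonneg) auto
  also have "(\<Prod>j\<in>UNIV. (u - l) $ e' j) * (\<Prod>i\<in>UNIV. (u - l) $ e i) = (\<Prod>l'\<in>range e' \<union> range e. (u - l) $ l')"
    using inj disjoint by (subst prod.union_disjoint) (auto simp: prod.reindex)
  also have "\<dots> = (\<Prod>b\<in>Basis. (u - l) \<bullet> b)"
    using cover by (simp add: prod_Basis_cart inner_axis Un_commute)
  finally show "emeasure (distr (lborel \<Otimes>\<^sub>M lborel) borel (join e e')) (box l u) =
      ennreal (\<Prod>b\<in>Basis. (u - l) \<bullet> b)" .
qed simp

text \<open>Fubini is applied to a Borel version \<open>g\<close> of \<open>F\<close>; the slices of
  \<open>F\<close> are then recovered for almost every \<open>y\<close>.\<close>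

lemma Fubini_join:
  fixes F :: "real^'n \<Rightarrow> complex"
  assumes "has_bochner_integral lebesgue F I"
  obtains J where "AE y in lborel. has_bochner_integral lebesgue (\<lambda>T. F (join e e' (y, T))) (J y)"
    and "has_bochner_integral lborel J I"
proof -
  obtain g where g: "has_bochner_integral lborel g I" and AE: "AE x in lborel. F x = g x"
    using assms by (rule has_bochner_integral_completion_imp)
  have meas: "g \<in> borel_measurable borel"
    using g by (auto elim: has_bochner_integral.cases)
  let ?h = "\<lambda>p. g (join e e' p)"
  have distr: "has_bochner_integral (distr (lborel \<Otimes>\<^sub>M lborel) borel (join e e')) g I"
    unfolding distr_join by (rule g)
  have h: "integrable (lborel \<Otimes>\<^sub>M lborel) ?h" "integral\<^sup>L (lborel \<Otimes>\<^sub>M lborel) ?h = I"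
    using distr integrable_distr_eq [OF borel_measurable_join meas]
      integral_distr [OF borel_measurable_join meas]
    unfolding has_bochner_integral_iff by metis+
  define J where "J y = (\<integral>T. ?h (y, T) \<partial>lborel)" for y
  \<comment> \<open>The exceptional null set pulls back along \<open>join\<close> to a null set,
    since \<open>join\<close> is measure preserving.\<close>
  have "AE p in lborel \<Otimes>\<^sub>M lborel. F (join e e' p) = ?h p"
    by (rule AE_distrD [OF borel_measurable_join]) (unfold distr_join, rule AE)
  then have "AE y in lborel. AE T in lborel. F (join e e' (y, T)) = ?h (y, T)"
    by (rule lborel_pair.AE_pair)
  moreover have "AE y in lborel. integrable lborel (\<lambda>T. ?h (y, T))"
    by (rule lborel_pair.AE_integrable_fst' [OF h(1)])
  ultimately have "AE y in lborel. has_bochner_integral lebesgue (\<lambda>T. F (join e e' (y, T))) (J y)"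
  proof eventually_elim
    case (elim y)
    then have "has_bochner_integral lborel (\<lambda>T. ?h (y, T)) (J y)"
      by (simp add: has_bochner_integral_iff J_def)
    then show ?case
      by (rule has_bochner_integral_lebesgue_AE [OF has_bochner_integral_completion elim(1)])
  qed
  moreover have "has_bochner_integral lborel J I"
    unfolding J_def [abs_def] has_bochner_integral_iff
    using lborel_pair.integrable_fst' [OF h(1)] lborel_pair.integral_fst' [OF h(1)] h(2) by simp
  ultimately show thesis
    by (rule that)
qed

text \<open>Here \<open>b\<close> may be an arbitrary function: each slice is treated at a fixed
  \<open>y\<close>, where \<open>b y\<close> is just a translation vector. The slice integral is
  therefore constant over the cube of the \<open>y\<close>, which has measure 1.\<close>

lemma periodic_integral_shear:
  fixes F :: "real^'n \<Rightarrow> complex" and G :: "real^'q \<Rightarrow> complex"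
  assumes per: "periodic G"
    and F: "\<And>y T. F (join e e' (y, T)) = G (T + b y)"
    and int: "has_bochner_integral lebesgue (\<lambda>x. indicator half_open_cube x *\<^sub>R F x) I"
  shows "has_bochner_integral lebesgue (\<lambda>T. indicator half_open_cube T *\<^sub>R G T) I"
proof -
  obtain J where J: "AE y in lborel. has_bochner_integral lebesgue
        (\<lambda>T. indicator half_open_cube (join e e' (y, T)) *\<^sub>R F (join e e' (y, T))) (J y)"
      and I: "has_bochner_integral lborel J I"
    using int by (rule Fubini_join)
  have slice: "AE y in lborel. (y \<in> cbox 0 1 \<longrightarrow>
      has_bochner_integral lebesgue (\<lambda>T. indicator half_open_cube T *\<^sub>R G T) (J y)) \<and>
      (y \<notin> cbox 0 1 \<longrightarrow> J y = 0)"
    using J AE_half_open_cube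
  proof eventually_elim
    case (elim y)
    show ?case
    proof (intro conjI impI)
      assume "y \<in> cbox 0 1"
      with elim have "has_bochner_integral lebesgue (\<lambda>T. indicator half_open_cube T *\<^sub>R G (T + b y)) (J y)"
        by (simp add: F indicator_def join_half_open_cube)
      moreover have "periodic (\<lambda>T. G (T + b y))"
        using per unfolding periodic_def by (metis add.assoc add.commute)
      ultimately show "has_bochner_integral lebesgue (\<lambda>T. indicator half_open_cube T *\<^sub>R G T) (J y)"
        \<comment> \<open>Shifting back by \<open>- b y\<close> also transfers integrability from
          the slice to \<open>G\<close> itself.\<close>
        using periodic_cube_translate [of "\<lambda>T. G (T + b y)" "J y" "- b y"] by simp
    next
      assume "y \<notin> cbox 0 1"
      with elim have "has_bochner_integral lebesgue (\<lambda>T::real^'q. 0::complex) (J y)"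
        by (simp add: indicator_def join_half_open_cube)
      then show "J y = 0"
        using has_bochner_integral_eq has_bochner_integral_zero by blast
    qed
  qed
  \<comment> \<open>The cube is not a null set, so some \<open>y\<close> in it satisfies
    \<open>slice\<close>. This one good slice supplies the integral of \<open>G\<close>.\<close>
  have "\<not> (AE y in lborel. y \<notin> cbox 0 (1 :: real^'d))"
    by (simp flip: AE_iff_null_sets add: null_sets_def emeasure_unit_cube)
  then obtain y where y: "has_bochner_integral lebesgue (\<lambda>T. indicator half_open_cube T *\<^sub>R G T) (J y)"
    using slice by (metis (mono_tags, lifting) eventually_mono)
  \<comment> \<open>Uniqueness of the integral of \<open>G\<close> forces \<open>J\<close> to take
    the value \<open>J y\<close> at almost every point of the cube; integrating over unit measure
    then gives \<open>J y = I\<close>.\<close>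
  have "AE x in lborel. J x = indicator (cbox 0 1) x *\<^sub>R J y"
    using slice
  proof eventually_elim
    case (elim x)
    then show ?case
      using has_bochner_integral_eq [OF y] by (auto simp: indicator_def)
  qed
  moreover have "has_bochner_integral lborel (\<lambda>x::real^'d. indicator (cbox 0 1) x *\<^sub>R J y) (J y)"
    using has_bochner_integral_indicator [of "cbox 0 (1::real^'d)" lborel "J y"]
    by (simp add: emeasure_unit_cube measure_def)
  ultimately have "has_bochner_integral lebesgue J (J y)"
    by (intro has_bochner_integral_lebesgue_AE [OF has_bochner_integral_completion])
  then have "J y = I"
    using has_bochner_integral_completion [OF I] by (rule has_bochner_integral_eq)
  with y show ?thesis
    by simp
qed

end

subsection \<open>Integer representations of a rational subspace\<close>

lemma linear_comb: "linear (comb v)"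
  by (rule linearI)
     (simp_all add: comb_def scaleR_add_left sum.distrib scaleR_right.sum)

lemma range_comb: "range (comb v) = span (range (\<lambda>j. rvec (v j)))"
proof
  show "range (comb v) \<subseteq> span (range (\<lambda>j. rvec (v j)))"
    by (auto simp: comb_def intro!: span_sum span_scale intro: span_base)
  have "rvec (v j) = comb v (axis j 1)" for j
    by (simp add: comb_def axis_def if_distrib [of "\<lambda>x. x *\<^sub>R _"] cong: if_cong)
  then show "span (range (\<lambda>j. rvec (v j))) \<subseteq> range (comb v)"
    by (intro span_minimal linear_subspace_image linear_comb subspace_UNIV) auto
qed

lemma range_axes_comb: "range (axes_comb e) = span (range (\<lambda>i. axis (e i) 1))"
proof
  show "range (axes_comb e) \<subseteq> span (range (\<lambda>i. axis (e i) 1))"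
    by (auto simp: axes_comb_def intro!: span_sum span_scale intro: span_base)
  have "axis (e i) 1 = axes_comb e (axis i 1)" for i
    by (simp add: axes_comb_def axis_def [of i] if_distrib [of "\<lambda>x. x *\<^sub>R _"] cong: if_cong)
  then show "span (range (\<lambda>i. axis (e i) 1)) \<subseteq> range (axes_comb e)"
    by (intro span_minimal linear_subspace_image linear_axes_comb subspace_UNIV) auto
qed

text \<open>The rational vectors whose real images lie in the real span form a rational subspace
  containing the generators.\<close>

lemma rat_span_imp_real_span:
  fixes x :: "rat^'n"
  assumes "x \<in> vec.span (range (\<lambda>j. qvec (w j)))"
  shows "(\<chi> i. of_rat (x $ i)) \<in> span (range (\<lambda>j. rvec (w j)))"
proof -
  let ?R = "\<lambda>x :: rat^'n. (\<chi> i. of_rat (x $ i)) :: real^'n"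
  let ?S = "{x. ?R x \<in> span (range (\<lambda>j. rvec (w j)))}"
  have add: "?R (x + y) = ?R x + ?R y" and scale: "?R (c *s x) = of_rat c *\<^sub>R ?R x"
    and zero: "?R 0 = 0" for x y c
    by (simp_all add: vec_eq_iff of_rat_add of_rat_mult)
  have "vec.subspace ?S"
    unfolding vec.subspace_def mem_Collect_eq add scale zero
    by (auto intro: span_add span_scale span_zero)
  moreover have "range (\<lambda>j. qvec (w j)) \<subseteq> ?S"
  proof -
    have "?R (qvec (w j)) = rvec (w j)" for j
      by (simp add: vec_eq_iff qvec_def rvec_def)
    then show ?thesis
      by (auto intro: span_base)
  qed
  ultimately show ?thesis
    using assms vec.span_minimal by blast
qed

text \<open>The Radon transform is computed with one integer basis of \<open>A\<close> and the
  coordinates with another; this carries translation invariance from one to the other.\<close>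

lemma represents_range_comb_subset:
  assumes "represents v A" "represents w A"
  shows "range (comb v) \<subseteq> range (comb w)"
proof -
  have "rvec (v j) \<in> span (range (\<lambda>j. rvec (w j)))" for j
  proof -
    have "qvec (v j) \<in> vec.span (range (\<lambda>j. qvec (v j)))"
      by (rule vec.span_base) simp
    then have "qvec (v j) \<in> vec.span (range (\<lambda>j. qvec (w j)))"
      using assms by (simp add: represents_def)
    from rat_span_imp_real_span [OF this] show ?thesis
      by (simp add: qvec_def rvec_def)
  qed
  then show ?thesis
    unfolding range_comb by (intro span_minimal) auto
qed

text \<open>Orthogonality to \<open>A\<close> is tested on the integer generators, where it is an
  identity between integers, and then extends to real coefficients by linearity.\<close>

lemma perp_comb:
  assumes "represents w A" "perp k A"
  shows "rvec k \<bullet> comb w s = 0"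
proof -
  have "rvec k \<bullet> rvec (w j) = 0" for j
  proof -
    have "qvec (w j) \<in> A"
      using assms(1) vec.span_superset by (fastforce simp: represents_def)
    then have "(\<Sum>i\<in>UNIV. of_int (k $ i) * qvec (w j) $ i) = 0"
      using assms(2) by (simp add: perp_def)
    then have "of_int (\<Sum>i\<in>UNIV. k $ i * w j $ i) = (0 :: rat)"
      by (simp add: qvec_def)
    then show ?thesis
      unfolding rvec_inner of_int_eq_0_iff by simp
  qed
  then show ?thesis
    by (simp add: comb_def inner_sum_right)
qed

subsection \<open>The Fourier coefficient formula\<close>

lemma radon_character:
  assumes "\<And>s. rvec k \<bullet> comb w s = 0"
  shows "radon w (character k) = character k"
proof
  fix x
  have "character k (x + comb w t) = character k x" for t
    by (simp add: character_def inner_add_right assms)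
  then show "radon w (character k) x = character k x"
    by (simp add: radon_def set_lebesgue_integral_def measure_def emeasure_unit_cube)
qed

lemma set_integrable_mult_character:
  assumes "set_integrable lebesgue (cbox 0 1) F"
  shows "set_integrable lebesgue (cbox 0 1) (\<lambda>x. F x * character k x)"
  unfolding set_integrable_def
proof (rule Bochner_Integration.integrable_bound)
  show int: "integrable lebesgue (\<lambda>x. indicator (cbox 0 1) x *\<^sub>R F x)"
    using assms by (simp add: set_integrable_def)
  have "continuous_on UNIV (character k)"
    by (intro differentiable_imp_continuous_on) (simp add: differentiable_on_def character_differentiable)
  then have "character k \<in> borel_measurable lebesgue"
    by (intro measurable_completion) (simp add: borel_measurable_continuous_onI)
  then have "(\<lambda>x. (indicator (cbox 0 1) x *\<^sub>R F x) * character k x) \<in> borel_measurable lebesgue"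
    using int by (intro borel_measurable_times) auto
  then show "(\<lambda>x. indicator (cbox 0 1) x *\<^sub>R (F x * character k x)) \<in> borel_measurable lebesgue"
    by simp
  have "norm (character k x) = 1" for x
    by (simp add: character_def)
  then show "AE x in lebesgue. norm (indicator (cbox 0 1) x *\<^sub>R (F x * character k x)) \<le>
      norm (indicator (cbox 0 1) x *\<^sub>R F x)"
    by (simp add: norm_mult)
qed

text \<open>Links the closed cube, over which the torus integrals are defined, with the half-open
  one, on which the lattice arguments run.\<close>

lemma has_bochner_integral_half_open_cube_iff:
  fixes F :: "real^'n \<Rightarrow> complex"
  shows "has_bochner_integral lebesgue (\<lambda>x. indicator half_open_cube x *\<^sub>R F x) I \<longleftrightarrow>
    set_integrable lebesgue (cbox 0 1) F \<and> (LINT x:cbox 0 1|lebesgue. F x) = I"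
proof -
  have AE: "AE x in lborel. indicator half_open_cube x *\<^sub>R F x = indicator (cbox 0 1) x *\<^sub>R F x"
    using AE_half_open_cube by eventually_elim (simp add: indicator_def)
  then have AE': "AE x in lborel. indicator (cbox 0 1) x *\<^sub>R F x = indicator half_open_cube x *\<^sub>R F x"
    by eventually_elim (rule sym)
  have "has_bochner_integral lebesgue (\<lambda>x. indicator half_open_cube x *\<^sub>R F x) I \<longleftrightarrow>
    has_bochner_integral lebesgue (\<lambda>x. indicator (cbox 0 1) x *\<^sub>R F x) I"
    using has_bochner_integral_lebesgue_AE [OF _ AE] has_bochner_integral_lebesgue_AE [OF _ AE'] by blast
  then show ?thesis
    by (simp add: has_bochner_integral_iff set_integrable_def set_lebesgue_integral_def)
qed

text \<open>Since the chosen axes are standard unit vectors, \<open>axes_comb\<close> sends integer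
  vectors to integer vectors.\<close>

lemma periodic_axes_comb:
  assumes "periodic F"
  shows "periodic (\<lambda>T. F (axes_comb e T))"
proof -
  have "axes_comb e (rvec m) = rvec (\<Sum>i\<in>UNIV. m $ i *s axis (e i) 1)" for m
    by (simp add: axes_comb_def rvec_def vec_eq_iff axis_def if_distrib cong: if_cong)
  then show ?thesis
    using assms by (simp add: periodic_def linear_add [OF linear_axes_comb])
qed

lemma coordinate_partition_exists:
  fixes e :: "'q::finite \<Rightarrow> 'n::finite"
  assumes "inj e" "CARD('q) + CARD('d::finite) = CARD('n)"
  obtains e' :: "'d::finite \<Rightarrow> 'n" where "coordinate_partition e e'"
proof -
  have "card (- range e) = CARD('d)"
    using assms by (simp add: Compl_eq_Diff_UNIV card_Diff_subset card_image)
  then obtain e' :: "'d \<Rightarrow> 'n" where "bij_betw e' UNIV (- range e)"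
    using finite_same_card_bij [of "UNIV :: 'd set" "- range e"] by auto
  then have "coordinate_partition e e'"
    using assms(1) by unfold_locales (auto simp: bij_betw_def)
  then show thesis ..
qed

theorem proposition3p1:
  fixes A :: "(rat^'n) set" and k :: "int^'n"
    and v w :: "'d::finite \<Rightarrow> int^'n" and e :: "'q::finite \<Rightarrow> 'n"
    and f :: "(real^'n \<Rightarrow> complex) \<Rightarrow> complex" and Rf :: "real^'n \<Rightarrow> complex"
  assumes "2 \<le> CARD('n)" and "1 \<le> CARD('d)" and "CARD('d) \<le> CARD('n) - 1"
    and "CARD('q) = CARD('n) - CARD('d)"
    and "A \<in> Gr CARD('d)"
    and "represents v A" and "complementary_axes v e"
    and "f \<in> distributions"
    and "represents w A"
    and "Rf \<in> torus_L1"
    and "\<forall>g\<in>test_functions. radon_dist w f g = dist_of_fun Rf g"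
    and "\<forall>x s. Rf (x + comb w s) = Rf x"
    and "perp k A"
  shows "set_integrable lebesgue (cbox 0 1)
      (\<lambda>T. Rf (phi v e T 0) * exp (- 2 * of_real pi * \<i> *
             of_real (\<Sum>i\<in>UNIV. (rvec k \<bullet> axis (e i) 1) * T $ i))) \<and>
    fourier_coeff f k =
      (LINT T:cbox 0 1|lebesgue. Rf (phi v e T 0) * exp (- 2 * of_real pi * \<i> *
             of_real (\<Sum>i\<in>UNIV. (rvec k \<bullet> axis (e i) 1) * T $ i)))"
proof -
  define F where "F x = Rf x * character k x" for x
  define G where "G T = F (axes_comb e T)" for T
  have coeff: "fourier_coeff f k = (LINT x:cbox 0 1|lebesgue. F x)"
  proof -
    \<comment> \<open>The identity defining the Radon transform of \<open>f\<close> can be tested on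
      the character, which equals its own Radon transform because \<open>k\<close> is orthogonal to
      \<open>A\<close>.\<close>
    have "fourier_coeff f k = f (radon w (character k))"
      using radon_character [OF perp_comb [OF assms(9,13)]]
      by (simp add: fourier_coeff_def character_def [abs_def])
    also have "\<dots> = dist_of_fun Rf (character k)"
      using assms(11) character_test_function [of k] by (simp add: radon_dist_def)
    finally show ?thesis
      by (simp add: dist_of_fun_def F_def)
  qed
  have "periodic F" and "set_integrable lebesgue (cbox 0 1) F"
    using assms(10) periodic_character [of k] set_integrable_mult_character
    unfolding F_def [abs_def] torus_L1_def periodic_def by auto
  have F_invariant: "F (x + comb v s) = F x" for x s
  proof -
    obtain s' where s': "comb v s = comb w s'"
      using represents_range_comb_subset [OF assms(6,9)] by blast
    then have "character k (comb v s) = 1"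
      using perp_comb [OF assms(9,13)] by (simp add: character_def)
    then show ?thesis
      unfolding F_def character_add using s' assms(12) by simp
  qed
  obtain e' :: "'d \<Rightarrow> 'n" where "coordinate_partition e e'"
    using coordinate_partition_exists [of e] assms(1,3,4,7) unfolding complementary_axes_def
    by (metis One_nat_def le_add_diff_inverse2 diff_le_self le_trans)
  then interpret coordinate_partition e e' .
  \<comment> \<open>The spanning condition splits a vector along the leftover axes into a part along
    the chosen axes, the shear \<open>b y\<close>, and a part in the real span of \<open>v\<close>,
    which \<open>F\<close> ignores.\<close>
  have "\<exists>b. \<exists>s. axes_comb e' y = axes_comb e b + comb v s" for y
  proof -
    have "axes_comb e' y \<in> span (range (\<lambda>j. rvec (v j)) \<union> range (\<lambda>i. axis (e i) 1))"
      using assms(7) by (simp add: complementary_axes_def)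
    then show ?thesis
      unfolding span_Un range_comb [symmetric] range_axes_comb [symmetric]
      by (auto simp: add.commute)
  qed
  then obtain b s where bs: "axes_comb e' y = axes_comb e (b y) + comb v (s y)" for y
    by metis
  have "F (join e e' (y, T)) = G (T + b y)" for y T
    unfolding join_def G_def bs linear_add [OF linear_axes_comb] fst_conv snd_conv
    using F_invariant by (simp flip: add.assoc)
  then have "has_bochner_integral lebesgue (\<lambda>T. indicator half_open_cube T *\<^sub>R G T) (fourier_coeff f k)"
    using \<open>periodic F\<close> \<open>set_integrable lebesgue (cbox 0 1) F\<close> coeff
    by (intro periodic_integral_shear [where F = F and b = b])
       (simp_all add: G_def [abs_def] periodic_axes_comb has_bochner_integral_half_open_cube_iff)
  moreover have "G T = Rf (phi v e T 0) * exp (- 2 * of_real pi * \<i> *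
      of_real (\<Sum>i\<in>UNIV. (rvec k \<bullet> axis (e i) 1) * T $ i))" for T
  proof -
    have "phi v e T 0 = axes_comb e T"
      by (simp add: phi_def axes_comb_def linear_0 [OF linear_comb])
    moreover have "rvec k \<bullet> axes_comb e T = (\<Sum>i\<in>UNIV. (rvec k \<bullet> axis (e i) 1) * T $ i)"
      by (simp add: axes_comb_def inner_sum_right mult.commute)
    ultimately show ?thesis
      by (simp add: G_def F_def character_def)
  qed
  ultimately show ?thesis
    by (simp add: has_bochner_integral_half_open_cube_iff)
qed

end
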